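(* Let $p$ be an odd prime and let $A_p=A(G_p)$. For each type class $\mathcal{C}_{L,M}$ let $\mathbf{1}_{L,M}\in\mathbb{R}^{V(G_p)}$ be its indicator vector. Let $U=\operatorname{span}\{\mathbf{1}_{L,M}:(L,M)\in\mathcal{T}\}$, and for each $(L,M)\in\mathcal{T}$ let $$W_{L,M}=\Bigl\{x\in\mathbb{R}^{V(G_p)}:\ \operatorname{supp}(x)\subseteq\mathcal{C}_{L,M},\ \sum_{v\in\mathcal{C}_{L,M}}x_v=0\Bigr\}.$$ Then: (i) $\mathbb{R}^{V(G_p)}=U\oplus\bigoplus_{(L,M)\in\mathcal{T}}W_{L,M}$ is an $A_p$-invariant direct sum decomposition. (ii) On $U$, the matrix of $A_p$ relative to the basis $\{\mathbf{1}_{L,M}\}_{(L,M)\in\mathcal{T}}$ is $B_p:=(p-1)H_p-D_p$. (iii) If $L\ne M$, then $A_p|_{W_{L,M}}=0$. (iv) If $L=M$, then $A_p|_{W_{L,L}}=-I$. Consequently, the characteristic polynomial of $A_p$ is $$\chi_{A_p}(\lambda)=\lambda^{p(p+1)(p-2)}(\lambda+1)^{(p+1)(p-2)}\chi_{B_p}(\lambda).$$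
   Context: For $n\ge2$, $\mathbb{L}_n=\{a+bi+cj+dk: a,b,c,d\in\mathbb{Z}/n\mathbb{Z}\}$ is the ring of Lipschitz quaternions modulo $n$, with the usual relations $i^2=j^2=k^2=-1$, $ij=k=-ji$, $jk=i=-kj$, $ki=j=-ik$ taken modulo $n$. A nonzero element $x$ of a ring is a zero divisor if $xy=0$ or $yx=0$ for some nonzero $y$. $G_n=\Gamma(\mathbb{L}_n)$ is the simple undirected graph whose vertices are the nonzero zero divisors of $\mathbb{L}_n$, distinct $x,y$ being adjacent iff $xy=0$ or $yx=0$; $A(G_n)$ is its adjacency matrix. For an odd prime $p$, $\mathbb{L}_p$ is identified with $M_2(\mathbb{F}_p)$ via a fixed ring isomorphism, so the vertices of $G_p$ are the nonzero singular $2\times2$ matrices over $\mathbb{F}_p$. $\mathcal{L}$ is the set of the $p+1$ one-dimensional subspaces of $\mathbb{F}_p^2$, and $\mathcal{T}=\mathcal{L}\times\mathcal{L}$. For $L,M\in\mathcal{L}$, the type class is $\mathcal{C}_{L,M}=\{A\in M_2(\mathbb{F}_p): A\ne0,\ \det A=0,\ \operatorname{Ker}(A)=L,\ \operatorname{Im}(A)=M\}$. $H_p$ is the $\mathcal{T}\times\mathcal{T}$ $(0,1)$-matrix whose $((L,M),(L',M'))$ entry is $1$ iff $M=L'$ or $M'=L$; $D_p$ is the diagonal $\mathcal{T}\times\mathcal{T}$ matrix whose $((L,M),(L,M))$ entry is $1$ if $L=M$ and $0$ otherwise. $\chi_X(\lambda)=\det(\lambda I-X)$. *)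

theory Defs
  imports "HOL-Analysis.Analysis" "Berlekamp_Zassenhaus.Finite_Field"
begin

section \<open>Quaternions over a commutative ring\<close>

text \<open>\<open>Quat a b c d\<close> stands for $a + bi + cj + dk$.\<close>

datatype 'a quat = Quat (q_re: 'a) (q_i: 'a) (q_j: 'a) (q_k: 'a)

instantiation quat :: (comm_ring_1) ring_1
begin

definition zero_quat :: "'a quat" where "0 = Quat 0 0 0 0"
definition one_quat :: "'a quat" where "1 = Quat 1 0 0 0"

definition plus_quat :: "'a quat \<Rightarrow> 'a quat \<Rightarrow> 'a quat" where
  "x + y = Quat (q_re x + q_re y) (q_i x + q_i y) (q_j x + q_j y) (q_k x + q_k y)"

definition uminus_quat :: "'a quat \<Rightarrow> 'a quat" where
  "- x = Quat (- q_re x) (- q_i x) (- q_j x) (- q_k x)"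

definition minus_quat :: "'a quat \<Rightarrow> 'a quat \<Rightarrow> 'a quat" where
  "x - y = Quat (q_re x - q_re y) (q_i x - q_i y) (q_j x - q_j y) (q_k x - q_k y)"

definition times_quat :: "'a quat \<Rightarrow> 'a quat \<Rightarrow> 'a quat" where
  "x * y = Quat
     (q_re x * q_re y - q_i x * q_i y - q_j x * q_j y - q_k x * q_k y)
     (q_re x * q_i y + q_i x * q_re y + q_j x * q_k y - q_k x * q_j y)
     (q_re x * q_j y - q_i x * q_k y + q_j x * q_re y + q_k x * q_i y)
     (q_re x * q_k y + q_i x * q_j y - q_j x * q_i y + q_k x * q_re y)"

instance
  by standard
    (auto simp: zero_quat_def one_quat_def plus_quat_def uminus_quat_def minus_quat_def
       times_quat_def algebra_simps)

end

lemmas quat_arith = zero_quat_def one_quat_def plus_quat_def uminus_quat_def minus_quat_def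
  times_quat_def

lemma quat_relations:
  fixes i j k :: "'a::comm_ring_1 quat"
  assumes "i = Quat 0 1 0 0" "j = Quat 0 0 1 0" "k = Quat 0 0 0 1"
  shows "i * i = -1" "j * j = -1" "k * k = -1"
    "i * j = k" "j * i = - k" "j * k = i" "k * j = - i" "k * i = j" "i * k = - j"
  using assms by (auto simp: quat_arith)

instance quat :: (finite) finite
proof
  have "(UNIV :: 'a quat set) \<subseteq> (\<lambda>(a, b, c, d). Quat a b c d) ` UNIV"
    by (auto simp: image_iff) (metis quat.exhaust)
  then show "finite (UNIV :: 'a quat set)"
    by (rule finite_subset) simp
qed

text \<open>The ring $\mathbb{L}_n$, where $n \geq 2$ is the cardinality of the type \<open>'n\<close>.\<close>

type_synonym 'n lipschitz = "'n mod_ring quat"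


section \<open>The zero divisor graph\<close>

definition zero_divisor :: "'a::ring_1 \<Rightarrow> bool" where
  "zero_divisor x \<longleftrightarrow> x \<noteq> 0 \<and> (\<exists>y. y \<noteq> 0 \<and> (x * y = 0 \<or> y * x = 0))"

definition zd_adjacent :: "'a::ring_1 \<Rightarrow> 'a \<Rightarrow> bool" where
  "zd_adjacent x y \<longleftrightarrow> x \<noteq> y \<and> (x * y = 0 \<or> y * x = 0)"

lemma prime_dvd_two_squares_plus_one:
  fixes p :: nat
  assumes "prime p"
  shows "\<exists>a b :: int. int p dvd a\<^sup>2 + b\<^sup>2 + 1"
proof (cases "p = 2")
  case True
  have "int p dvd 1\<^sup>2 + 0\<^sup>2 + 1" using True by simp
  then show ?thesis by blast
next
  case False
  with assms have p: "odd p" "p > 2"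
    using prime_odd_nat prime_gt_1_nat[of p] by (auto simp: order_less_le)
  have pp: "prime (int p)" using assms by simp
  define h where "h = (int p - 1) div 2"
  have h: "int p = 2 * h + 1" using p by (auto simp: h_def elim!: oddE)
  have eq: "x = y" if "x \<in> {0..h}" "y \<in> {0..h}" "int p dvd x\<^sup>2 - y\<^sup>2" for x y
  proof -
    have "int p dvd (x - y) * (x + y)"
      using that(3) by (simp add: power2_eq_square algebra_simps)
    then have "int p dvd x - y \<or> int p dvd x + y"
      using pp prime_dvd_mult_iff by blast
    then show ?thesis
    proof
      assume "int p dvd x - y"
      moreover have "\<bar>x - y\<bar> < int p" using that h by auto
      ultimately show ?thesis using dvd_imp_le_int[of "x - y" "int p"] by fastforce
    next
      assume "int p dvd x + y"
      moreover have "\<bar>x + y\<bar> < int p" using that h by auto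
      ultimately have "x + y = 0" using dvd_imp_le_int[of "x + y" "int p"] by fastforce
      then show ?thesis using that by auto
    qed
  qed
  let ?f = "\<lambda>x::int. x\<^sup>2 mod int p" and ?g = "\<lambda>y::int. (- 1 - y\<^sup>2) mod int p"
  have f: "inj_on ?f {0..h}"
    by (rule inj_onI) (auto intro!: eq simp: mod_eq_dvd_iff)
  have g: "inj_on ?g {0..h}"
  proof (rule inj_onI)
    fix x y assume xy: "x \<in> {0..h}" "y \<in> {0..h}" and "?g x = ?g y"
    then have "int p dvd y\<^sup>2 - x\<^sup>2" by (simp add: mod_eq_dvd_iff)
    then show "x = y" using eq[of y x] xy by simp
  qed
  have "?f ` {0..h} \<inter> ?g ` {0..h} \<noteq> {}"
  proof
    assume disj: "?f ` {0..h} \<inter> ?g ` {0..h} = {}"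
    have "card (?f ` {0..h} \<union> ?g ` {0..h}) = 2 * nat (h + 1)"
      using disj f g by (simp add: card_Un_disjoint card_image)
    moreover have "card (?f ` {0..h} \<union> ?g ` {0..h}) \<le> card {0..<int p}"
      using p by (intro card_mono) auto
    ultimately show False using h by simp
  qed
  then obtain x y where "x\<^sup>2 mod int p = (- 1 - y\<^sup>2) mod int p" by auto
  then have "int p dvd x\<^sup>2 + y\<^sup>2 + 1" by (simp add: mod_eq_dvd_iff algebra_simps)
  then show ?thesis by blast
qed

lemma of_int_mod_ring_eq_0_iff:
  "of_int z = (0 :: 'n::nontriv mod_ring) \<longleftrightarrow> int CARD('n) dvd z"
  unfolding of_int_of_int_mod_ring by transfer (simp add: dvd_eq_mod_eq_0)

lemma mod_ring_two_squares:
  assumes "prime CARD('n::nontriv)"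
  shows "\<exists>a b :: 'n mod_ring. a * a + b * b + 1 = 0"
proof -
  obtain a b :: int where "int CARD('n) dvd a\<^sup>2 + b\<^sup>2 + 1"
    using prime_dvd_two_squares_plus_one[OF assms] by blast
  then have "of_int (a\<^sup>2 + b\<^sup>2 + 1) = (0 :: 'n mod_ring)"
    by (simp only: of_int_mod_ring_eq_0_iff)
  then show ?thesis by (auto simp: power2_eq_square)
qed

lemma lipschitz_zero_divisor_exists: "\<exists>x :: 'n::nontriv lipschitz. zero_divisor x"
proof (cases "prime CARD('n)")
  case True
  then obtain a b :: "'n mod_ring" where ab: "a * a + b * b + 1 = 0"
    using mod_ring_two_squares by blast
  have "Quat 1 a b 0 * Quat 1 (- a) (- b) 0 = 0"
    using ab by (simp add: quat_arith algebra_simps)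
  moreover have "Quat 1 a b 0 \<noteq> 0" "Quat 1 (- a) (- b) 0 \<noteq> 0"
    by (auto simp: quat_arith)
  ultimately show ?thesis unfolding zero_divisor_def by blast
next
  case False
  have "CARD('n) > 1" by (rule nontriv)
  then obtain m k where mk: "CARD('n) = m * k" "1 < m" "m < CARD('n)"
    using False by (auto simp: prime_nat_iff elim!: dvdE)
      (metis One_nat_def dvd_triv_left less_one linorder_neqE_nat mult_is_0 nat_dvd_not_less
        not_less_zero zero_less_iff_neq_zero nat_neq_iff mult.right_neutral)
  then have k: "1 < k" "k < CARD('n)"
    by (auto intro: Suc_lessI)
  have nz: "of_int (int l) \<noteq> (0 :: 'n mod_ring)" if "1 < l" "l < CARD('n)" for l
    unfolding of_int_mod_ring_eq_0_iff using that by (auto dest: nat_dvd_not_less[rotated -1])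
  have "of_int (int m) * of_int (int k) = (0 :: 'n mod_ring)"
    using mk(1) by (metis of_int_mult of_int_mod_ring_eq_0_iff dvd_refl of_nat_mult)
  then have "Quat (of_int (int m)) 0 0 0 * Quat (of_int (int k)) 0 0 0 = (0 :: 'n lipschitz)"
    by (simp add: quat_arith)
  moreover have "Quat (of_int (int m)) 0 0 0 \<noteq> (0 :: 'n lipschitz)"
      "Quat (of_int (int k)) 0 0 0 \<noteq> (0 :: 'n lipschitz)"
    using nz[of m] nz[of k] mk k by (auto simp: quat_arith)
  ultimately show ?thesis unfolding zero_divisor_def by blast
qed

text \<open>The vertex set of $G_n$ is made a type so that it can index vectors and matrices.\<close>

typedef ('n::nontriv) vertex = "{x :: 'n lipschitz. zero_divisor x}"
  using lipschitz_zero_divisor_exists by auto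

instance vertex :: (nontriv) finite
proof
  show "finite (UNIV :: 'a vertex set)"
    by (rule inj_on_finite[of Rep_vertex _ UNIV]) (auto simp: inj_on_def Rep_vertex_inject)
qed

definition adj_matrix :: "real ^ ('n::nontriv vertex) ^ ('n vertex)" where
  "adj_matrix = (\<chi> x y. if zd_adjacent (Rep_vertex x) (Rep_vertex y) then 1 else 0)"


section \<open>Identification of the quaternions modulo p with matrices\<close>

definition matrix_ring_iso :: "('p::prime_card lipschitz \<Rightarrow> 'p mod_ring ^ 2 ^ 2) \<Rightarrow> bool" where
  "matrix_ring_iso \<phi> \<longleftrightarrow> bij \<phi> \<and> \<phi> 1 = mat 1 \<and>
     (\<forall>x y. \<phi> (x + y) = \<phi> x + \<phi> y) \<and> (\<forall>x y. \<phi> (x * y) = \<phi> x ** \<phi> y)"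

lemma matrix_ring_iso_exists:
  assumes "odd CARD('p::prime_card)"
  shows "\<exists>\<phi> :: 'p lipschitz \<Rightarrow> 'p mod_ring ^ 2 ^ 2. matrix_ring_iso \<phi>"
proof -
  obtain a b :: "'p mod_ring" where ab: "a * a + b * b + 1 = 0"
    using mod_ring_two_squares[OF prime_card] by blast
  then have bb: "b * b = - 1 - a * a" by (simp add: algebra_simps eq_neg_iff_add_eq_0)
  have bb': "b * (b * c) = - c - a * (a * c)" for c
    using arg_cong[OF bb, of "\<lambda>z. z * c"] by (simp add: algebra_simps)
  have two: "(2 :: 'p mod_ring) \<noteq> 0"
  proof
    assume "(2 :: 'p mod_ring) = 0"
    then have "of_int 2 = (0 :: 'p mod_ring)" by simp
    then have "int CARD('p) dvd 2" by (simp only: of_int_mod_ring_eq_0_iff)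
    then have "CARD('p) dvd 2" by presburger
    then have "CARD('p) = 2" using prime_card[where 'a='p] two_is_prime_nat primes_dvd_imp_eq by blast
    with assms show False by simp
  qed
  define \<phi> :: "'p lipschitz \<Rightarrow> 'p mod_ring ^ 2 ^ 2" where
    "\<phi> = (\<lambda>x. vector [vector [q_re x + a * q_j x - b * q_k x, b * q_j x + a * q_k x - q_i x],
               vector [q_i x + b * q_j x + a * q_k x, q_re x - a * q_j x + b * q_k x]])"
  have inj: "x = 0" if "\<phi> x = 0" for x
  proof -
    obtain w r s t where x: "x = Quat w r s t" by (cases x)
    from that have e: "w + a * s - b * t = 0" "b * s + a * t - r = 0"
        "r + b * s + a * t = 0" "w - a * s + b * t = 0"
      by (auto simp: \<phi>_def x vec_eq_iff forall_2 vector_2)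
    have "2 * w = (w + a * s - b * t) + (w - a * s + b * t)" by (simp add: algebra_simps)
    then have w: "w = 0" using e two by simp
    have "2 * r = (r + b * s + a * t) - (b * s + a * t - r)" by (simp add: algebra_simps)
    then have r: "r = 0" using e two by simp
    have e1: "a * s - b * t = 0" and e2: "b * s + a * t = 0" using e w r by auto
    have "a * (a * s - b * t) + b * (b * s + a * t) = - s"
      by (simp add: algebra_simps bb')
    then have s: "s = 0" using e1 e2 by simp
    have "a * (b * s + a * t) - b * (a * s - b * t) = - t"
      by (simp add: algebra_simps bb')
    then have t: "t = 0" using e1 e2 by simp
    show ?thesis using w r s t x by (simp add: quat_arith)
  qed
  have add: "\<phi> (x + y) = \<phi> x + \<phi> y" for x y
    by (simp add: \<phi>_def quat_arith vec_eq_iff forall_2 vector_2 algebra_simps)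
  have mult: "\<phi> (x * y) = \<phi> x ** \<phi> y" for x y
    by (simp add: \<phi>_def quat_arith vec_eq_iff forall_2 vector_2 matrix_matrix_mult_def sum_2
          algebra_simps bb bb')
  have one: "\<phi> 1 = mat 1"
    by (simp add: \<phi>_def quat_arith vec_eq_iff forall_2 vector_2 mat_def)
  have "inj \<phi>"
  proof (rule injI)
    fix x y assume "\<phi> x = \<phi> y"
    moreover have "\<phi> x = \<phi> (x - y) + \<phi> y" using add[of "x - y" y] by simp
    ultimately have "\<phi> (x - y) = 0" by simp
    then show "x = y" using inj[of "x - y"] by simp
  qed
  moreover have "surj \<phi>"
  proof -
    have "CARD('p lipschitz) = CARD('p) ^ 4"
    proof -
      have "bij_betw (\<lambda>(a, b, c, d). Quat a b c d) UNIV (UNIV :: 'p lipschitz set)"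
        by (auto simp: bij_betw_def inj_on_def image_iff) (metis quat.exhaust)
      then have "CARD('p mod_ring \<times> 'p mod_ring \<times> 'p mod_ring \<times> 'p mod_ring) = CARD('p lipschitz)"
        by (rule bij_betw_same_card)
      then show ?thesis by (simp add: power_def numeral_eq_Suc)
    qed
    also have "\<dots> = CARD('p mod_ring ^ 2 ^ 2)"
      by (simp add: CARD_vec power_mult[symmetric])
    finally have "card (range \<phi>) = CARD('p mod_ring ^ 2 ^ 2)"
      using \<open>inj \<phi>\<close> by (simp add: card_image)
    then show ?thesis by (intro card_subset_eq) auto
  qed
  ultimately show ?thesis
    unfolding matrix_ring_iso_def bij_def using add mult one by blast
qed


section \<open>Types\<close>

text \<open>A line is a one-dimensional subspace of $\mathbb{F}_p^2$; the index set $\mathcal{T}$ is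
  the type \<open>'p line \<times> 'p line\<close>.\<close>

typedef ('p::prime_card) line = "{S :: ('p mod_ring ^ 2) set. vec.subspace S \<and> vec.dim S = 1}"
proof
  have "axis 1 1 \<noteq> (0 :: 'p mod_ring ^ 2)" by (simp add: axis_eq_0_iff)
  then show "vec.span {axis 1 1 :: 'p mod_ring ^ 2} \<in> {S. vec.subspace S \<and> vec.dim S = 1}"
    by (simp add: vec.dim_span)
qed

instance line :: (prime_card) finite
proof
  show "finite (UNIV :: 'a line set)"
    by (rule inj_on_finite[of Rep_line _ UNIV]) (auto simp: inj_on_def Rep_line_inject)
qed

definition matrix_class :: "'p::prime_card line \<Rightarrow> 'p line \<Rightarrow> ('p mod_ring ^ 2 ^ 2) set" where
  "matrix_class L M = {A. A \<noteq> 0 \<and> det A = 0 \<and>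
     {v. A *v v = 0} = Rep_line L \<and> range ((*v) A) = Rep_line M}"

text \<open>The type class as a set of vertices of $G_p$, along the identification \<open>\<phi>\<close>.\<close>

definition vertex_class ::
  "('p::prime_card lipschitz \<Rightarrow> 'p mod_ring ^ 2 ^ 2) \<Rightarrow> 'p line \<times> 'p line \<Rightarrow> 'p vertex set" where
  "vertex_class \<phi> t = {v. \<phi> (Rep_vertex v) \<in> matrix_class (fst t) (snd t)}"

definition H_matrix :: "real ^ ('p::prime_card line \<times> 'p line) ^ ('p line \<times> 'p line)" where
  "H_matrix = (\<chi> s t. if snd s = fst t \<or> snd t = fst s then 1 else 0)"

definition D_matrix :: "real ^ ('p::prime_card line \<times> 'p line) ^ ('p line \<times> 'p line)" where
  "D_matrix = (\<chi> s t. if s = t \<and> fst s = snd s then 1 else 0)"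

definition class_indicator ::
  "('p::prime_card lipschitz \<Rightarrow> 'p mod_ring ^ 2 ^ 2) \<Rightarrow> 'p line \<times> 'p line \<Rightarrow> real ^ 'p vertex" where
  "class_indicator \<phi> t = (\<chi> v. indicator (vertex_class \<phi> t) v)"

definition U_space :: "('p::prime_card lipschitz \<Rightarrow> 'p mod_ring ^ 2 ^ 2) \<Rightarrow> (real ^ 'p vertex) set" where
  "U_space \<phi> = span (range (class_indicator \<phi>))"

definition W_space ::
  "('p::prime_card lipschitz \<Rightarrow> 'p mod_ring ^ 2 ^ 2) \<Rightarrow> 'p line \<times> 'p line \<Rightarrow> (real ^ 'p vertex) set" where
  "W_space \<phi> t = {x. {v. x $ v \<noteq> 0} \<subseteq> vertex_class \<phi> t \<and> (\<Sum>v\<in>vertex_class \<phi> t. x $ v) = 0}"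


section \<open>Linear algebra\<close>

definition is_direct_sum :: "('i::finite \<Rightarrow> 'v::real_vector set) \<Rightarrow> bool" where
  "is_direct_sum X \<longleftrightarrow> (\<forall>i. subspace (X i)) \<and>
     (\<forall>x. \<exists>!f. (\<forall>i. f i \<in> X i) \<and> x = (\<Sum>i\<in>UNIV. f i))"

text \<open>The family \<open>b\<close> is a basis of \<open>V\<close>, and \<open>V\<close> is invariant under \<open>f\<close>, whose matrix in that
  basis is \<open>B\<close>: column \<open>t\<close> of \<open>B\<close> holds the coordinates of \<open>f (b t)\<close>.\<close>

definition has_matrix_in_basis ::
  "('v::real_vector \<Rightarrow> 'v) \<Rightarrow> 'v set \<Rightarrow> ('i::finite \<Rightarrow> 'v) \<Rightarrow> real ^ 'i ^ 'i \<Rightarrow> bool" where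
  "has_matrix_in_basis f V b B \<longleftrightarrow>
     inj b \<and> independent (range b) \<and> span (range b) = V \<and>
     (\<forall>t. f (b t) = (\<Sum>s\<in>UNIV. B $ s $ t *\<^sub>R b s))"

definition charpoly :: "real ^ 'n ^ 'n \<Rightarrow> real poly" where
  "charpoly X = det (mat [:0, 1:] - (\<chi> i j. [:X $ i $ j:]))"

end

theory Submission
  imports Defs
begin

text \<open>
  Whether two nonzero singular matrices multiply to zero depends only on their kernels and images:
  $AB = 0$ says $\operatorname{Im} B \subseteq \operatorname{Ker} A$, and a line contained in a
  line is equal to it (\<open>class_mult_eq_0_iff\<close>).  So two vertices $x$, $y$ of the same type
  $(L,M)$ are twins: they have the same neighbours outside $\{x, y\}$.  Up to a diagonal
  correction, which only records that the graph has no loops, the adjacency matrix is therefore the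
  pullback of \<open>H_matrix\<close> along the map that sends a vertex to its type
  (\<open>twin_partition_vertex_type\<close>).

  Everything that concerns the spectrum is true of any matrix of this shape,
  $A_{vw} = M_{c(v)c(w)} + \delta_{vw} d_{c(v)}$ with $c$ surjective, and is proved in the locale
  \<open>twin_partition\<close>.  A vector on one fibre of $c$ with sum zero is killed by the pulled back
  part, so $A$ acts on it as the scalar $d$ of that fibre.  A vector constant on fibres is mapped to
  another one, through the quotient matrix in which $M$ is weighted by the sizes of the fibres.
  Averaging over the fibres shows that these two kinds of vectors decompose the whole space.
  For the characteristic polynomial one conjugates $\lambda I - A$ by elementary operations that
  subtract a chosen representative of a fibre from its other elements.  The rows of these other
  elements become diagonal, with entry $\lambda - d$, and what remains on the representatives is
  $\lambda I$ minus the quotient matrix.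

  It remains to count.  A nonzero singular $2 \times 2$ matrix is a product of a column $m$ and a
  row that annihilates a vector $l$, where $m$ spans the image and $l$ the kernel.  Fixing both lines
  leaves a nonzero scalar, so every type class has $p - 1$ elements
  (\<open>card_matrix_class\<close>), and there are $p + 1$ lines (\<open>card_line\<close>).  Of the
  $(p+1)^2$ types, $p + 1$ are diagonal and have $d = -1$, the other $p(p+1)$ have $d = 0$; each
  contributes its factor with exponent $p - 2$.
\<close>

section \<open>A determinant with diagonal rows\<close>

text \<open>In the Leibniz expansion a permutation that moves an index outside the range of $r$ contributes
  zero.  The others permute that range, and conjugation by $r$ identifies them, with their signs,
  with the permutations indexing the smaller determinant.\<close>
lemma det_block_of_diagonal_rows:
  fixes X :: "'a::comm_ring_1 ^ 'v ^ 'v" and r :: "'t::finite \<Rightarrow> 'v"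
  assumes inj: "inj r"
    and diag: "\<And>v w. v \<notin> range r \<Longrightarrow> w \<noteq> v \<Longrightarrow> X $ v $ w = 0"
  shows "det X = (\<Prod>v\<in>- range r. X $ v $ v) * det (\<chi> s t. X $ r s $ r t)"
proof -
  let ?term = "\<lambda>q. of_int (sign q) * (\<Prod>v\<in>UNIV. X $ v $ q v)"
  let ?block = "\<lambda>q. of_int (sign q) * (\<Prod>s\<in>UNIV. X $ r s $ r (q s))"
  have "det X = (\<Sum>q | q permutes UNIV. ?term q)"
    by (simp add: det_def)
  also have "\<dots> = (\<Sum>q | q permutes range r. ?term q)"
  proof (rule sum.mono_neutral_right)
    show "\<forall>q\<in>{q. q permutes UNIV} - {q. q permutes range r}. ?term q = 0"
    proof
      fix q assume "q \<in> {q. q permutes (UNIV :: 'v set)} - {q. q permutes range r}"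
      then obtain v where "v \<notin> range r" "q v \<noteq> v"
        using permutes_superset[of q UNIV "range r"] by auto
      then have "(\<Prod>v\<in>UNIV. X $ v $ q v) = 0"
        using diag by (intro prod_zero) auto
      then show "?term q = 0" by simp
    qed
  qed (auto intro: permutes_subset finite_permutations)
  also have "\<dots> = (\<Sum>q | q permutes UNIV. (\<Prod>v\<in>- range r. X $ v $ v) * ?block q)"
  proof (rule sum.reindex_bij_witness[where i = "map_permutation UNIV r"
        and j = "map_permutation (range r) (inv_into UNIV r)"])
    fix q assume "q \<in> {q. q permutes range r}"
    then have q: "q permutes range r" by simp
    have bij: "bij_betw (inv_into UNIV r) (range r) UNIV"
      using inj by (intro bij_betw_inv_into inj_on_imp_bij_betw)
    show "map_permutation UNIV r (map_permutation (range r) (inv_into UNIV r) q) = q"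
      using bij q by (rule map_permutation_compose_inv) (auto simp: f_inv_into_f)
    show p: "map_permutation (range r) (inv_into UNIV r) q \<in> {q. q permutes UNIV}"
      using map_permutation_permutes[OF bij q] by simp
    let ?p = "map_permutation (range r) (inv_into UNIV r) q"
    have q_r: "q (r s) = r (?p s)" for s
    proof -
      have "?p (inv_into UNIV r (r s)) = inv_into UNIV r (q (r s))"
        by (rule map_permutation_apply) (auto intro: inj_on_inv_into)
      moreover have "q (r s) \<in> range r" using permutes_in_image[OF q] by blast
      ultimately show ?thesis using inj by (simp add: f_inv_into_f)
    qed
    have "(\<Prod>v\<in>UNIV. X $ v $ q v)
        = (\<Prod>v\<in>- range r. X $ v $ q v) * (\<Prod>v\<in>range r. X $ v $ q v)"
      unfolding Compl_eq_Diff_UNIV by (rule prod.subset_diff) auto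
    also have "(\<Prod>v\<in>- range r. X $ v $ q v) = (\<Prod>v\<in>- range r. X $ v $ v)"
      using permutes_not_in[OF q] by (intro prod.cong) auto
    also have "(\<Prod>v\<in>range r. X $ v $ q v) = (\<Prod>s\<in>UNIV. X $ r s $ r (?p s))"
      using inj by (simp add: prod.reindex q_r)
    finally show "(\<Prod>v\<in>- range r. X $ v $ v) * ?block ?p = ?term q"
      using sign_map_permutation[OF _ q finite, of "inv_into UNIV r"]
      by (simp add: inj_on_inv_into algebra_simps)
  next
    fix q assume "q \<in> {q. q permutes (UNIV :: 't set)}"
    then have q: "q permutes UNIV" by simp
    have bij: "bij_betw r UNIV (range r)" using inj by (simp add: bij_betw_def)
    show "map_permutation (range r) (inv_into UNIV r) (map_permutation UNIV r q) = q"
      using bij q by (rule map_permutation_compose_inv) (auto simp: inj)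
    show "map_permutation UNIV r q \<in> {q. q permutes range r}"
      using map_permutation_permutes[OF bij q] by simp
  qed
  also have "\<dots> = (\<Prod>v\<in>- range r. X $ v $ v) * det (\<chi> s t. X $ r s $ r t)"
    by (simp add: det_def sum_distrib_left)
  finally show ?thesis .
qed

section \<open>Matrices constant on the blocks of a partition\<close>

text \<open>Elements with the same value of \<open>c\<close> are twins; \<open>d\<close> corrects the diagonal of the
  pulled back matrix.  For a graph this is how loops are removed, as twins may be adjacent to each
  other but never to themselves.\<close>
locale twin_partition =
  fixes c :: "'v::finite \<Rightarrow> 't::finite"
    and M :: "real ^ 't ^ 't" and d :: "'t \<Rightarrow> real" and A :: "real ^ 'v ^ 'v"
  assumes surj_c: "surj c"
    and entry: "A $ v $ w = M $ c v $ c w + (if v = w then d (c v) else 0)"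
begin

definition fibre :: "'t \<Rightarrow> 'v set" where "fibre t = {v. c v = t}"

definition fibre_indicator :: "'t \<Rightarrow> real ^ 'v" where
  "fibre_indicator t = (\<chi> v. if c v = t then 1 else 0)"

definition zero_sum :: "'t \<Rightarrow> (real ^ 'v) set" where
  "zero_sum t = {x. (\<forall>v. c v \<noteq> t \<longrightarrow> x $ v = 0) \<and> (\<Sum>v\<in>fibre t. x $ v) = 0}"

definition quotient_matrix :: "real ^ 't ^ 't" where
  "quotient_matrix = (\<chi> s t. real (card (fibre t)) * M $ s $ t + (if s = t then d s else 0))"

lemma card_fibre_pos: "card (fibre t) > 0"
proof -
  obtain v where "c v = t" using surj_c by (metis surjD)
  then show ?thesis by (auto simp: card_gt_0_iff fibre_def)
qed

text \<open>Evaluating a combination of indicators reads off one coefficient.  Since every fibre is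
  nonempty, this identifies the span and gives independence.\<close>
lemma sum_fibre_indicator_nth: "(\<Sum>s\<in>UNIV. a s *\<^sub>R fibre_indicator s) $ v = a (c v)"
  by (simp add: fibre_indicator_def if_distrib[of "(*) _"] cong: if_cong)

lemma span_fibre_indicator: "span (range fibre_indicator) = {x. \<exists>a. \<forall>v. x $ v = a (c v)}"
proof
  have "subspace {x :: real ^ 'v. \<exists>a. \<forall>v. x $ v = a (c v)}"
    unfolding subspace_def
  proof (intro conjI ballI allI)
    show "(0 :: real ^ 'v) \<in> {x. \<exists>a. \<forall>v. x $ v = a (c v)}"
      by (auto intro: exI[of _ "\<lambda>_. 0"])
    fix x y :: "real ^ 'v" and k :: real
    assume x: "x \<in> {x. \<exists>a. \<forall>v. x $ v = a (c v)}"
    then obtain a where a: "\<forall>v. x $ v = a (c v)" by auto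
    show "k *\<^sub>R x \<in> {x. \<exists>a. \<forall>v. x $ v = a (c v)}"
      using a by (auto intro: exI[of _ "\<lambda>t. k * a t"])
    assume "y \<in> {x. \<exists>a. \<forall>v. x $ v = a (c v)}"
    then obtain b where "\<forall>v. y $ v = b (c v)" by auto
    then show "x + y \<in> {x. \<exists>a. \<forall>v. x $ v = a (c v)}"
      using a by (auto intro: exI[of _ "\<lambda>t. a t + b t"])
  qed
  moreover have "range fibre_indicator \<subseteq> {x. \<exists>a. \<forall>v. x $ v = a (c v)}"
  proof
    fix x assume "x \<in> range fibre_indicator"
    then obtain t where "x = fibre_indicator t" by auto
    then show "x \<in> {x. \<exists>a. \<forall>v. x $ v = a (c v)}"
      by (auto simp: fibre_indicator_def intro!: exI[of _ "\<lambda>s. if s = t then 1 else 0"])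
  qed
  ultimately show "span (range fibre_indicator) \<subseteq> {x. \<exists>a. \<forall>v. x $ v = a (c v)}"
    by (rule span_minimal[rotated])
next
  show "{x. \<exists>a. \<forall>v. x $ v = a (c v)} \<subseteq> span (range fibre_indicator)"
  proof
    fix x :: "real ^ 'v" assume "x \<in> {x. \<exists>a. \<forall>v. x $ v = a (c v)}"
    then obtain a where "\<forall>v. x $ v = a (c v)" by auto
    then have "x = (\<Sum>s\<in>UNIV. a s *\<^sub>R fibre_indicator s)"
      unfolding vec_eq_iff sum_fibre_indicator_nth by simp
    moreover have "(\<Sum>s\<in>UNIV. a s *\<^sub>R fibre_indicator s) \<in> span (range fibre_indicator)"
      by (intro span_sum span_scale span_base rangeI)
    ultimately show "x \<in> span (range fibre_indicator)" by simp
  qed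
qed

lemma inj_fibre_indicator: "inj fibre_indicator"
proof (rule injI)
  fix s t assume "fibre_indicator s = fibre_indicator t"
  moreover obtain v where "c v = s" using surj_c by (metis surjD)
  ultimately have "(if s = s then 1 else 0 :: real) = (if s = t then 1 else 0)"
    by (simp only: fibre_indicator_def vec_eq_iff vec_lambda_beta) metis
  then show "s = t" by (auto split: if_splits)
qed

lemma independent_fibre_indicator: "independent (range fibre_indicator)"
proof (rule independent_if_scalars_zero)
  fix f x assume sum: "(\<Sum>x\<in>range fibre_indicator. f x *\<^sub>R x) = 0" and "x \<in> range fibre_indicator"
  then obtain t where t: "x = fibre_indicator t" by auto
  obtain v where v: "c v = t" using surj_c by (metis surjD)
  have "(\<Sum>s\<in>UNIV. f (fibre_indicator s) *\<^sub>R fibre_indicator s) = 0"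
    using sum by (simp add: sum.reindex[OF inj_fibre_indicator] o_def)
  then show "f x = 0" using sum_fibre_indicator_nth[of "\<lambda>s. f (fibre_indicator s)" v] v t by simp
qed simp

lemma mult_fibre_indicator: "A *v fibre_indicator t = (\<Sum>s\<in>UNIV. quotient_matrix $ s $ t *\<^sub>R fibre_indicator s)"
proof (simp only: vec_eq_iff sum_fibre_indicator_nth, rule allI)
  fix v
  have "(A *v fibre_indicator t) $ v = (\<Sum>w\<in>fibre t. A $ v $ w)"
    by (simp add: matrix_vector_mult_def fibre_indicator_def fibre_def sum.If_cases if_distrib[of "(*) _"]
        cong: if_cong)
  also have "\<dots> = (\<Sum>w\<in>fibre t. M $ c v $ t) + (\<Sum>w\<in>fibre t. if v = w then d t else 0)"
    by (subst sum.distrib[symmetric], rule sum.cong) (auto simp: entry fibre_def)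
  also have "\<dots> = quotient_matrix $ c v $ t"
    by (auto simp: quotient_matrix_def fibre_def)
  finally show "(A *v fibre_indicator t) $ v = quotient_matrix $ c v $ t" .
qed

lemma has_matrix_in_basis_fibre_indicator:
  "has_matrix_in_basis ((*v) A) (span (range fibre_indicator)) fibre_indicator quotient_matrix"
  by (simp add: has_matrix_in_basis_def inj_fibre_indicator independent_fibre_indicator mult_fibre_indicator)

text \<open>On the fibre of $t$ the entries $M_{c(v)c(w)}$ do not depend on $w$, so they multiply the sum of
  \<open>x\<close>, which is zero; only the diagonal correction acts.\<close>
lemma mult_zero_sum:
  assumes "x \<in> zero_sum t"
  shows "A *v x = d t *\<^sub>R x"
proof (simp only: vec_eq_iff, rule allI)
  fix v
  have supp: "x $ w = 0" if "c w \<noteq> t" for w using assms that by (simp add: zero_sum_def)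
  have "(A *v x) $ v = (\<Sum>w\<in>UNIV. M $ c v $ c w * x $ w)
      + (\<Sum>w\<in>UNIV. if v = w then d (c v) * x $ w else 0)"
    unfolding matrix_vector_mult_def vec_lambda_beta sum.distrib[symmetric]
    by (rule sum.cong) (auto simp: entry algebra_simps)
  also have "(\<Sum>w\<in>UNIV. M $ c v $ c w * x $ w) = (\<Sum>w\<in>fibre t. M $ c v $ t * x $ w)"
    by (rule sum.mono_neutral_cong_right) (auto simp: fibre_def supp)
  also have "\<dots> = 0" using assms by (simp add: zero_sum_def sum_distrib_left[symmetric])
  also have "(\<Sum>w\<in>UNIV. if v = w then d (c v) * x $ w else 0) = (d t *\<^sub>R x) $ v"
    using supp[of v] by (cases "c v = t") auto
  finally show "(A *v x) $ v = (d t *\<^sub>R x) $ v" by simp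
qed

lemma subspace_zero_sum: "subspace (zero_sum t)"
  by (auto simp: subspace_def zero_sum_def sum.distrib sum_distrib_left[symmetric])

lemma mult_zero_sum_invariant: "x \<in> zero_sum t \<Longrightarrow> A *v x \<in> zero_sum t"
  using mult_zero_sum[of x t] subspace_scale[OF subspace_zero_sum] by metis

lemma mult_span_fibre_indicator: 
  assumes "x \<in> span (range fibre_indicator)" shows "A *v x \<in> span (range fibre_indicator)"
proof -
  have "range fibre_indicator \<subseteq> (*v) A -` span (range fibre_indicator)"
  proof
    fix y assume "y \<in> range fibre_indicator"
    then obtain t where "y = fibre_indicator t" by auto
    moreover have "A *v fibre_indicator t \<in> span (range fibre_indicator)"
      unfolding mult_fibre_indicator by (intro span_sum span_scale span_base rangeI)
    ultimately show "y \<in> (*v) A -` span (range fibre_indicator)" by simp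
  qed
  then have "span (range fibre_indicator) \<subseteq> (*v) A -` span (range fibre_indicator)"
    by (intro span_minimal linear_subspace_vimage matrix_vector_mul_linear subspace_span)
  then show ?thesis using assms by auto
qed

lemma sum_zero_sum_nth:
  assumes "\<And>t. g t \<in> zero_sum t"
  shows "(\<Sum>t\<in>UNIV. g t) $ v = g (c v) $ v"
proof -
  have "(\<Sum>t\<in>UNIV. g t $ v) = (\<Sum>t\<in>{c v}. g t $ v)"
    using assms by (intro sum.mono_neutral_right) (auto simp: zero_sum_def)
  then show ?thesis by simp
qed

text \<open>The component constant on fibres must be the mean over each fibre, because the other components
  do not change sums over fibres; what is left is then cut into its restrictions to fibres.\<close>
lemma decomposition: "is_direct_sum (case_option (span (range fibre_indicator)) zero_sum)"
proof -
  let ?X = "case_option (span (range fibre_indicator)) zero_sum"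
  define mean where "mean x t = (\<Sum>v\<in>fibre t. x $ v) / card (fibre t)" for x :: "real ^ 'v" and t
  have sum_mean: "card (fibre t) * mean x t = (\<Sum>v\<in>fibre t. x $ v)" for x t
    using card_fibre_pos[of t] by (simp add: mean_def)
  have split: "(\<Sum>i\<in>UNIV. f i) = f None + (\<Sum>t\<in>UNIV. f (Some t))"
    for f :: "'t option \<Rightarrow> real ^ 'v"
    by (simp add: UNIV_option_conv sum.reindex)
  have "\<exists>!f. (\<forall>i. f i \<in> ?X i) \<and> x = (\<Sum>i\<in>UNIV. f i)" for x
  proof
    define f where "f = case_option (\<chi> v. mean x (c v))
      (\<lambda>t. \<chi> v. if c v = t then x $ v - mean x t else 0)"
    have U: "f None \<in> ?X None" by (auto simp: f_def span_fibre_indicator)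
    have W: "f (Some t) \<in> zero_sum t" for t
    proof -
      have "(\<Sum>v\<in>fibre t. f (Some t) $ v) = (\<Sum>v\<in>fibre t. x $ v - mean x t)"
        by (rule sum.cong) (auto simp: f_def fibre_def)
      also have "\<dots> = 0" by (simp add: sum_subtractf sum_mean)
      finally show ?thesis by (auto simp: zero_sum_def f_def)
    qed
    have "x = (\<Sum>i\<in>UNIV. f i)"
      unfolding split vec_eq_iff vector_add_component sum_zero_sum_nth[OF W] by (simp add: f_def)
    then show "(\<forall>i. f i \<in> ?X i) \<and> x = (\<Sum>i\<in>UNIV. f i)"
      using U W by (auto split: option.splits)
    fix g assume g: "(\<forall>i. g i \<in> ?X i) \<and> x = (\<Sum>i\<in>UNIV. g i)"
    have gU: "g None \<in> span (range fibre_indicator)" and gW: "g (Some t) \<in> zero_sum t" for t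
      using g[THEN conjunct1, rule_format, of None] g[THEN conjunct1, rule_format, of "Some t"]
      by auto
    obtain a where a: "\<And>v. g None $ v = a (c v)" using gU by (auto simp: span_fibre_indicator)
    have x: "x $ v = a (c v) + g (Some (c v)) $ v" for v
      using g sum_zero_sum_nth[OF gW, of v] by (simp add: split a)
    have mean: "mean x t = a t" for t
    proof -
      have "(\<Sum>v\<in>fibre t. x $ v) = (\<Sum>v\<in>fibre t. a t + g (Some t) $ v)"
        by (rule sum.cong) (auto simp: x fibre_def)
      also have "\<dots> = card (fibre t) * a t" using gW[of t] by (simp add: sum.distrib zero_sum_def)
      finally show ?thesis using card_fibre_pos[of t] by (simp add: mean_def card_gt_0_iff)
    qed
    show "g = f"
    proof
      fix i show "g i = f i"
      proof (cases i)
        case None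
        then show ?thesis by (simp add: f_def vec_eq_iff a mean)
      next
        case (Some t)
        then show ?thesis using gW[of t] by (auto simp: f_def vec_eq_iff zero_sum_def mean x)
      qed
    qed
  qed
  then show ?thesis
    by (auto simp: is_direct_sum_def subspace_zero_sum split: option.splits)
qed

text \<open>Each fibre of size $n$ splits off $n - 1$ copies of its eigenvalue $d$: the differences between
  its elements and one representative are eigenvectors.  The proof realises this change of basis by
  an inverse pair $E$, $F$ of polynomial matrices, so that nothing has to be divided by
  $\lambda - d$.\<close>
lemma charpoly_eq:
  "charpoly A = (\<Prod>t\<in>UNIV. [:- d t, 1:] ^ (card (fibre t) - 1)) * charpoly quotient_matrix"
proof -
  obtain r where r: "\<And>t. c (r t) = t" using surj_c by (metis surjD)
  have inj_r: "inj r" by (metis injI r)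
  have R: "v \<in> range r \<longleftrightarrow> v = r (c v)" for v using r by force
  define C :: "real poly ^ 'v ^ 'v" where "C = mat [:0, 1:] - (\<chi> v w. [:A $ v $ w:])"
  have C: "C $ v $ w = (if v = w then [:- d (c v), 1:] else 0) - [:M $ c v $ c w:]" for v w
    by (simp add: C_def mat_def entry)
  \<comment> \<open>Left multiplication by \<open>E\<close> subtracts the row of the representative from every other row
     of its fibre; right multiplication by \<open>F\<close> adds the columns of a fibre to the column of its
     representative.\<close>
  define E :: "real poly ^ 'v ^ 'v" where
    "E = (\<chi> v w. (if v = w then 1 else 0) - (if v \<notin> range r \<and> w = r (c v) then 1 else 0))"
  define F :: "real poly ^ 'v ^ 'v" where
    "F = (\<chi> v w. (if v = w then 1 else 0) + (if v \<notin> range r \<and> w = r (c v) then 1 else 0))"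
  have E_mult: "(E ** X) $ v $ w = X $ v $ w - (if v \<notin> range r then X $ r (c v) $ w else 0)"
    for X v w
  proof -
    have "(E ** X) $ v $ w = (\<Sum>u\<in>UNIV. if v = u then X $ u $ w else 0)
        - (\<Sum>u\<in>UNIV. if u = r (c v) then (if v \<notin> range r then X $ u $ w else 0) else 0)"
      unfolding matrix_matrix_mult_def sum_subtractf[symmetric]
      by (auto simp: E_def algebra_simps intro!: sum.cong)
    then show ?thesis by simp
  qed
  have F_mult: "(X ** F) $ v $ w = X $ v $ w
      + (if w \<in> range r then (\<Sum>u\<in>fibre (c w) - range r. X $ v $ u) else 0)" for X v w
  proof -
    have "(X ** F) $ v $ w = (\<Sum>u\<in>UNIV. if u = w then X $ v $ u else 0)
        + (\<Sum>u\<in>UNIV. if u \<notin> range r \<and> w = r (c u) then X $ v $ u else 0)"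
      unfolding matrix_matrix_mult_def sum.distrib[symmetric]
      by (auto simp: F_def algebra_simps intro!: sum.cong)
    also have "(\<Sum>u\<in>UNIV. if u \<notin> range r \<and> w = r (c u) then X $ v $ u else 0)
        = (\<Sum>u | u \<notin> range r \<and> w = r (c u). X $ v $ u)"
      by (simp add: sum.If_cases)
    also have "{u. u \<notin> range r \<and> w = r (c u)} = (if w \<in> range r then fibre (c w) - range r else {})"
      using r by (auto simp: fibre_def)
    finally show ?thesis by simp
  qed
  have "E ** F = mat 1"
    unfolding vec_eq_iff E_mult by (auto simp: F_def mat_def r)
  then have "det E * det F = 1" by (metis det_I det_mul)
  then have "det C = det (E ** C ** F)"
    by (simp add: det_mul mult.commute mult.left_commute)
  also have "\<dots> = (\<Prod>v\<in>- range r. (E ** C ** F) $ v $ v)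
      * det (\<chi> s t. (E ** C ** F) $ r s $ r t)"
  proof (rule det_block_of_diagonal_rows[OF inj_r])
    fix v w assume v: "v \<notin> range r" and "w \<noteq> v"
    \<comment> \<open>Twins have the same row of \<open>M\<close>, which therefore cancels.\<close>
    have EC: "(E ** C) $ v $ u = (if v = u then [:- d (c v), 1:] else 0)
        - (if r (c v) = u then [:- d (c v), 1:] else 0)" for u
      using v by (auto simp: E_mult C r)
    have "(\<Sum>u\<in>fibre (c w) - range r. (E ** C) $ v $ u)
        = (\<Sum>u\<in>fibre (c w) - range r. if v = u then [:- d (c v), 1:] else 0)"
      by (rule sum.cong) (auto simp: EC)
    also have "\<dots> = (if c v = c w then [:- d (c v), 1:] else 0)"
      using v by (auto simp: fibre_def)
    finally have "(E ** C ** F) $ v $ w = (E ** C) $ v $ w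
        + (if w \<in> range r then if c v = c w then [:- d (c v), 1:] else 0 else 0)"
      by (simp only: F_mult)
    moreover have "r (c v) = w \<longleftrightarrow> w \<in> range r \<and> c v = c w"
      using R[of w] r by metis
    ultimately show "(E ** C ** F) $ v $ w = 0"
      using \<open>w \<noteq> v\<close> by (simp only: EC) simp
  qed
  also have "(\<chi> s t. (E ** C ** F) $ r s $ r t)
      = mat [:0, 1:] - (\<chi> s t. [:quotient_matrix $ s $ t:])"
  proof (simp only: vec_eq_iff, intro allI)
    fix s t
    have "(E ** C ** F) $ r s $ r t = (\<Sum>u\<in>insert (r t) (fibre t - range r). C $ r s $ u)"
      by (subst sum.insert) (auto simp: F_mult E_mult r)
    also have "insert (r t) (fibre t - range r) = fibre t"
      using R by (auto simp: fibre_def r)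
    also have "(\<Sum>u\<in>fibre t. C $ r s $ u)
        = (\<Sum>u\<in>fibre t. if r s = u then [:- d s, 1:] else 0) - (\<Sum>u\<in>fibre t. [:M $ s $ t:])"
      unfolding sum_subtractf[symmetric] by (rule sum.cong) (auto simp: C r fibre_def)
    also have "\<dots> = (mat [:0, 1:] - (\<chi> s t. [:quotient_matrix $ s $ t:])) $ s $ t"
      by (auto simp: quotient_matrix_def mat_def fibre_def r of_nat_poly)
    finally show "(\<chi> s t. (E ** C ** F) $ r s $ r t) $ s $ t
        = (mat [:0, 1:] - (\<chi> s t. [:quotient_matrix $ s $ t:])) $ s $ t" by simp
  qed
  also have "(\<Prod>v\<in>- range r. (E ** C ** F) $ v $ v)
      = (\<Prod>v\<in>- range r. [:- d (c v), 1:])"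
  proof (rule prod.cong)
    fix v assume v: "v \<in> - range r"
    then show "(E ** C ** F) $ v $ v = [:- d (c v), 1:]"
      using R[of v] by (auto simp: F_mult E_mult C r)
  qed simp
  also have "\<dots> = (\<Prod>t\<in>UNIV. \<Prod>v | v \<in> - range r \<and> c v = t. [:- d (c v), 1:])"
    by (rule prod.group[symmetric]) auto
  also have "\<dots> = (\<Prod>t\<in>UNIV. [:- d t, 1:] ^ (card (fibre t) - 1))"
  proof (rule prod.cong)
    fix t
    have "{v \<in> - range r. c v = t} = fibre t - {r t}" using R by (auto simp: fibre_def r)
    moreover have "card (fibre t - {r t}) = card (fibre t) - 1"
      by (rule card_Diff_singleton) (simp add: fibre_def r)
    ultimately show "(\<Prod>v | v \<in> - range r \<and> c v = t. [:- d (c v), 1:])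
        = [:- d t, 1:] ^ (card (fibre t) - 1)" 
      by (simp add: fibre_def)
  qed simp
  finally show ?thesis by (simp add: charpoly_def C_def)
qed

end


section \<open>Singular matrices of size two\<close>

text \<open>The product of the column $m$ and the row $(-l_2, l_1)$.  The row is the functional
  $x \mapsto \det(l, x)$, which makes \<open>l\<close> a generator of the kernel.\<close>
definition dyad :: "'a::field ^ 2 \<Rightarrow> 'a ^ 2 \<Rightarrow> 'a ^ 2 ^ 2" where
  "dyad m l = (\<chi> i j. m $ i * (if j = 1 then - l $ 2 else l $ 1))"

lemma dyad_mult_vec: "dyad m l *v x = (l $ 1 * x $ 2 - l $ 2 * x $ 1) *s m"
  by (simp add: dyad_def matrix_vector_mult_def vec_eq_iff sum_2 algebra_simps)

lemma dyad_scale: "dyad (a *s m) (b *s l) = dyad ((a * b) *s m) l"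
  by (simp add: dyad_def vec_eq_iff algebra_simps)

lemma det_dyad: "det (dyad m l) = 0"
  by (simp add: det_2 dyad_def)

lemma dyad_nonzero:
  assumes "m \<noteq> 0" "l \<noteq> 0"
  shows "dyad m l \<noteq> 0"
  using assms by (auto simp: dyad_def vec_eq_iff forall_2)

lemma dyad_cancel:
  assumes "dyad (a *s m) l = dyad (b *s m) l" "m \<noteq> 0" "l \<noteq> 0"
  shows "a = b"
  using assms by (auto simp: dyad_def vec_eq_iff forall_2)

lemma mem_span_iff_parallel:
  fixes l x :: "'a::field ^ 2"
  assumes "l \<noteq> 0"
  shows "x \<in> vec.span {l} \<longleftrightarrow> l $ 1 * x $ 2 = l $ 2 * x $ 1"
proof
  assume "x \<in> vec.span {l}"
  then show "l $ 1 * x $ 2 = l $ 2 * x $ 1"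
    by (auto simp: vec.span_singleton)
next
  assume eq: "l $ 1 * x $ 2 = l $ 2 * x $ 1"
  obtain k where "x = k *s l"
  proof (cases "l $ 1 = 0")
    case True
    then have l2: "l $ 2 \<noteq> 0" using assms by (simp add: vec_eq_iff forall_2)
    then have "x $ 1 = 0" using eq True by simp
    then show ?thesis using that[of "x $ 2 / l $ 2"] l2 True by (simp add: vec_eq_iff forall_2)
  next
    case False
    then show ?thesis using that[of "x $ 1 / l $ 1"] eq
      by (simp add: vec_eq_iff forall_2 field_simps)
  qed
  then show "x \<in> vec.span {l}" by (auto simp: vec.span_singleton)
qed

lemma kernel_dyad:
  assumes "m \<noteq> 0" "l \<noteq> 0"
  shows "{x. dyad m l *v x = 0} = vec.span {l}"
  using assms by (auto simp: dyad_mult_vec mem_span_iff_parallel vec.scale_eq_0_iff)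

lemma range_dyad:
  fixes l m :: "'a::field ^ 2"
  assumes "l \<noteq> 0"
  shows "range ((*v) (dyad m l)) = vec.span {m}"
proof -
  have "\<exists>x :: 'a ^ 2. k = l $ 1 * x $ 2 - l $ 2 * x $ 1" for k
  proof (cases "l $ 1 = 0")
    case True
    then have "l $ 2 \<noteq> 0" using assms by (simp add: vec_eq_iff forall_2)
    then show ?thesis using True by (intro exI[of _ "vector [- k / l $ 2, 0]"]) simp
  next
    case False
    then show ?thesis by (intro exI[of _ "vector [0, k / l $ 1]"]) (simp add: vector_2)
  qed
  then have "range (\<lambda>x :: 'a ^ 2. l $ 1 * x $ 2 - l $ 2 * x $ 1) = UNIV"
    by (auto simp: surj_def)
  then have "(\<lambda>k. k *s m) ` range (\<lambda>x :: 'a ^ 2. l $ 1 * x $ 2 - l $ 2 * x $ 1) = vec.span {m}"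
    by (simp only: vec.span_singleton)
  moreover have "(*v) (dyad m l) = (\<lambda>x. (l $ 1 * x $ 2 - l $ 2 * x $ 1) *s m)"
    by (simp add: fun_eq_iff dyad_mult_vec)
  ultimately show ?thesis by (simp only: image_image)
qed

lemma singular_imp_dyad:
  fixes A :: "'a::field ^ 2 ^ 2"
  assumes "A \<noteq> 0" "det A = 0"
  obtains m l where "m \<noteq> 0" "l \<noteq> 0" "A = dyad m l"
proof (cases "A $ 1 = 0")
  case True
  then show ?thesis
    using assms(1) that[of "vector [0, 1]" "vector [A $ 2 $ 2, - A $ 2 $ 1]"]
    by (auto simp: dyad_def vec_eq_iff forall_2)
next
  case False
  have det: "A $ 1 $ 1 * A $ 2 $ 2 = A $ 1 $ 2 * A $ 2 $ 1" using assms(2) by (simp add: det_2)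
  have "A $ 2 \<in> vec.span {A $ 1}"
    using False det by (simp add: mem_span_iff_parallel)
  then obtain t where "A $ 2 = t *s A $ 1" by (auto simp: vec.span_singleton)
  then show ?thesis
    using False that[of "vector [1, t]" "vector [A $ 1 $ 2, - A $ 1 $ 1]"]
    by (auto simp: dyad_def vec_eq_iff forall_2)
qed

lemma span_scale_singleton:
  fixes m :: "'a::field ^ 2"
  assumes "k \<noteq> 0"
  shows "vec.span {k *s m} = vec.span {m}"
proof -
  have "k *s m \<in> vec.span {m}" by (intro vec.span_scale vec.span_base) simp
  moreover have "inverse k *s (k *s m) \<in> vec.span {k *s m}"
    by (intro vec.span_scale vec.span_base) simp
  then have "m \<in> vec.span {k *s m}" using assms by simp
  ultimately show ?thesis
    by (intro equalityI vec.span_minimal vec.subspace_span) simp_all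
qed

section \<open>Lines and type classes\<close>

lemma line_eq_span:
  obtains l where "l \<noteq> 0" "Rep_line L = vec.span {l}"
proof -
  have L: "vec.subspace (Rep_line L)" "vec.dim (Rep_line L) = 1"
    using Rep_line[of L] by auto
  have "\<not> Rep_line L \<subseteq> {0}" using L(2) by (metis vec.dim_eq_0 zero_neq_one)
  then obtain l where l: "l \<in> Rep_line L" "l \<noteq> 0" by auto
  then have "vec.span {l} \<subseteq> Rep_line L" using L(1) by (simp add: vec.span_minimal)
  then have "vec.span {l} = Rep_line L"
    by (rule vec.subspace_dim_equal[OF vec.subspace_span L(1)])
      (use l L in \<open>simp add: vec.dim_span\<close>)
  then show ?thesis using that l by simp
qed

lemma Rep_Abs_line_span: "l \<noteq> 0 \<Longrightarrow> Rep_line (Abs_line (vec.span {l})) = vec.span {l}"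
  by (rule Abs_line_inverse) (simp add: vec.dim_span)

lemma line_subset_imp_eq:
  assumes "Rep_line L \<subseteq> Rep_line M"
  shows "L = M"
proof -
  have "Rep_line L = Rep_line M"
    by (rule vec.subspace_dim_equal) (use assms Rep_line[of L] Rep_line[of M] in auto)
  then show ?thesis by (simp add: Rep_line_inject)
qed

text \<open>Every line has exactly one generator of the form $(1, a)$ or $(0, 1)$.\<close>
lemma card_line: "CARD('p::prime_card line) = CARD('p) + 1"
proof -
  define e :: "'p mod_ring option \<Rightarrow> 'p mod_ring ^ 2" where
    "e = case_option (vector [0, 1]) (\<lambda>a. vector [1, a])"
  have nz: "e i \<noteq> 0" for i by (cases i) (auto simp: e_def vec_eq_iff forall_2)
  have "bij (\<lambda>i. Abs_line (vec.span {e i}))"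
  proof (rule bijI)
    show "inj (\<lambda>i. Abs_line (vec.span {e i}))"
    proof (rule injI)
      fix i j assume "Abs_line (vec.span {e i}) = Abs_line (vec.span {e j})"
      then have "vec.span {e i} = vec.span {e j}" using nz Rep_Abs_line_span by metis
      then have "e j \<in> vec.span {e i}" using vec.span_base by blast
      then have "e i $ 1 * e j $ 2 = e i $ 2 * e j $ 1"
        using mem_span_iff_parallel[OF nz] by blast
      then show "i = j" by (cases i; cases j) (auto simp: e_def)
    qed
    show "surj (\<lambda>i. Abs_line (vec.span {e i}))"
      unfolding surj_def
    proof
      fix L :: "'p line"
      obtain l where l: "l \<noteq> 0" "Rep_line L = vec.span {l}" by (rule line_eq_span)
      \<comment> \<open>The slope of the line, with \<open>None\<close> standing for the vertical line.\<close>
      define i where "i = (if l $ 1 = 0 then None else Some (l $ 2 / l $ 1))"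
      have "e i \<in> vec.span {l}"
        using l(1) by (auto simp: mem_span_iff_parallel i_def e_def)
      then have "Rep_line (Abs_line (vec.span {e i})) \<subseteq> Rep_line L"
        unfolding Rep_Abs_line_span[OF nz] l(2) by (simp add: vec.span_minimal)
      then show "\<exists>i. L = Abs_line (vec.span {e i})" using line_subset_imp_eq by blast
    qed
  qed
  then have "CARD('p mod_ring option) = CARD('p line)" by (rule bij_betw_same_card)
  then show ?thesis by simp
qed

text \<open>The kernel and the image determine both factors of a dyad up to scalars, and the two scalars can
  be merged into one.\<close>
lemma matrix_class_eq_image:
  assumes l: "l \<noteq> 0" "Rep_line L = vec.span {l}" and m: "m \<noteq> 0" "Rep_line M = vec.span {m}"
  shows "matrix_class L M = (\<lambda>k. dyad (k *s m) l) ` (- {0})"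
proof
  show "matrix_class L M \<subseteq> (\<lambda>k. dyad (k *s m) l) ` (- {0})"
  proof
    fix A assume A: "A \<in> matrix_class L M"
    obtain m' l' where ml: "m' \<noteq> 0" "l' \<noteq> 0" "A = dyad m' l'"
      by (rule singular_imp_dyad[of A]) (use A in \<open>auto simp: matrix_class_def\<close>)
    have "l' \<in> vec.span {l}" "m' \<in> vec.span {m}"
      using A ml l m vec.span_base[of l' "{l'}"] vec.span_base[of m' "{m'}"]
      by (auto simp: matrix_class_def kernel_dyad range_dyad)
    then obtain a b where ab: "m' = a *s m" "l' = b *s l" by (auto simp: vec.span_singleton)
    then have "A = dyad ((a * b) *s m) l" using ml by (simp add: dyad_scale)
    moreover have "a * b \<noteq> 0" using ab ml by auto
    ultimately show "A \<in> (\<lambda>k. dyad (k *s m) l) ` (- {0})" by auto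
  qed
  show "(\<lambda>k. dyad (k *s m) l) ` (- {0}) \<subseteq> matrix_class L M"
  proof
    fix A assume "A \<in> (\<lambda>k. dyad (k *s m) l) ` (- {0})"
    then obtain k where k: "k \<noteq> 0" "A = dyad (k *s m) l" by auto
    then have "k *s m \<noteq> 0" using m(1) by (simp add: vec.scale_eq_0_iff)
    then show "A \<in> matrix_class L M"
      using k l m by (simp add: matrix_class_def dyad_nonzero det_dyad kernel_dyad range_dyad
          span_scale_singleton)
  qed
qed

lemma card_matrix_class: "card (matrix_class L M :: ('p::prime_card mod_ring ^ 2 ^ 2) set) = CARD('p) - 1"
proof -
  obtain l where l: "l \<noteq> 0" "Rep_line L = vec.span {l}" by (rule line_eq_span)
  obtain m where m: "m \<noteq> 0" "Rep_line M = vec.span {m}" by (rule line_eq_span)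
  have "inj_on (\<lambda>k. dyad (k *s m) l) (- {0})"
    by (rule inj_onI) (use l m dyad_cancel in blast)
  then have "card (matrix_class L M) = card (- {0 :: 'p mod_ring})"
    by (simp add: matrix_class_eq_image[OF l m] card_image)
  then show ?thesis by (simp add: Compl_eq_Diff_UNIV card_Diff_subset)
qed

lemma singular_imp_class:
  assumes "A \<noteq> 0" "det A = 0"
  shows "\<exists>L M. A \<in> matrix_class L M"
proof -
  obtain m l where "m \<noteq> 0" "l \<noteq> 0" "A = dyad m l" using singular_imp_dyad assms by blast
  then have "A \<in> matrix_class (Abs_line (vec.span {l})) (Abs_line (vec.span {m}))"
    using assms by (simp add: matrix_class_def Rep_Abs_line_span kernel_dyad range_dyad)
  then show ?thesis by blast
qed

lemma matrix_class_unique: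
  assumes "A \<in> matrix_class L M" "A \<in> matrix_class L' M'"
  shows "L = L'" "M = M'"
  using assms by (auto simp: matrix_class_def Rep_line_inject[symmetric])

lemma class_mult_eq_0_iff:
  assumes A: "A \<in> matrix_class L M" and B: "B \<in> matrix_class L' M'"
  shows "A ** B = 0 \<longleftrightarrow> M' = L"
proof -
  have "A ** B = 0 \<longleftrightarrow> (\<forall>x. A *v (B *v x) = 0)"
    by (simp add: matrix_eq matrix_vector_mul_assoc)
  also have "\<dots> \<longleftrightarrow> range ((*v) B) \<subseteq> {v. A *v v = 0}" by auto
  also have "\<dots> \<longleftrightarrow> Rep_line M' \<subseteq> Rep_line L"
    using A B by (simp add: matrix_class_def)
  also have "\<dots> \<longleftrightarrow> M' = L" using line_subset_imp_eq by blast
  finally show ?thesis .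
qed

section \<open>The types of the vertices\<close>

definition vertex_type ::
  "('p::prime_card lipschitz \<Rightarrow> 'p mod_ring ^ 2 ^ 2) \<Rightarrow> 'p vertex \<Rightarrow> 'p line \<times> 'p line" where
  "vertex_type \<phi> v = (THE t. v \<in> vertex_class \<phi> t)"

text \<open>A matrix of type $(L, M)$ squares to zero exactly when $L = M$.  Then \<open>H_matrix\<close> has the
  diagonal entry $1$, which would be a loop.\<close>
definition loop_correction :: "'p::prime_card line \<times> 'p line \<Rightarrow> real" where
  "loop_correction t = (if fst t = snd t then - 1 else 0)"

context
  fixes \<phi> :: "'p::prime_card lipschitz \<Rightarrow> 'p mod_ring ^ 2 ^ 2"
  assumes iso: "matrix_ring_iso \<phi>"
begin

lemma iso_mult: "\<phi> (x * y) = \<phi> x ** \<phi> y"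
  using iso by (simp add: matrix_ring_iso_def)

lemma iso_eq_0_iff: "\<phi> x = 0 \<longleftrightarrow> x = 0"
proof -
  have "\<phi> (0 + 0) = \<phi> 0 + \<phi> 0" using iso unfolding matrix_ring_iso_def by blast
  then have "\<phi> 0 = 0" by simp
  moreover have "inj \<phi>" using iso by (simp add: matrix_ring_iso_def bij_def)
  ultimately show ?thesis by (metis injD)
qed

lemma iso_surj: "\<exists>x. A = \<phi> x"
  using iso unfolding matrix_ring_iso_def bij_def surj_def by blast

lemma mult_eq_0_iff_iso: "x * y = 0 \<longleftrightarrow> \<phi> x ** \<phi> y = 0"
  by (metis iso_mult iso_eq_0_iff)

text \<open>An invertible factor can be cancelled, so a zero divisor is singular.  Conversely a matrix with
  kernel spanned by $l$ annihilates any matrix whose image is spanned by $l$, such as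
  \<open>dyad l l\<close>.\<close>
lemma zero_divisor_iff_singular: "zero_divisor x \<longleftrightarrow> \<phi> x \<noteq> 0 \<and> det (\<phi> x) = 0"
proof
  assume x: "zero_divisor x"
  then obtain y where y: "\<phi> y \<noteq> 0" "\<phi> x ** \<phi> y = 0 \<or> \<phi> y ** \<phi> x = 0"
    by (auto simp: zero_divisor_def mult_eq_0_iff_iso iso_eq_0_iff)
  have "\<not> invertible (\<phi> x)"
  proof
    assume "invertible (\<phi> x)"
    then obtain B where B: "\<phi> x ** B = mat 1" "B ** \<phi> x = mat 1"
      by (auto simp: invertible_def)
    have "B ** \<phi> x ** \<phi> y = \<phi> y" "\<phi> y ** (\<phi> x ** B) = \<phi> y" by (simp_all add: B)
    then have "B ** (\<phi> x ** \<phi> y) = \<phi> y" "(\<phi> y ** \<phi> x) ** B = \<phi> y"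
      by (simp_all add: matrix_mul_assoc)
    with y show False by auto
  qed
  then show "\<phi> x \<noteq> 0 \<and> det (\<phi> x) = 0"
    using x by (simp add: invertible_det_nz iso_eq_0_iff zero_divisor_def)
next
  assume x: "\<phi> x \<noteq> 0 \<and> det (\<phi> x) = 0"
  then obtain m l where ml: "m \<noteq> 0" "l \<noteq> 0" "\<phi> x = dyad m l" using singular_imp_dyad by blast
  obtain y where y: "dyad l l = \<phi> y" using iso_surj by blast
  have "\<phi> x ** \<phi> y = 0"
    by (simp add: matrix_eq ml(3) y[symmetric] dyad_mult_vec algebra_simps
        flip: matrix_vector_mul_assoc)
  moreover have "\<phi> y \<noteq> 0" using dyad_nonzero[OF ml(2) ml(2)] y by simp
  ultimately show "zero_divisor x"
    using x unfolding zero_divisor_def by (metis iso_eq_0_iff mult_eq_0_iff_iso)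
qed

lemma ex1_vertex_class: "\<exists>!t. v \<in> vertex_class \<phi> t"
proof -
  have "\<phi> (Rep_vertex v) \<noteq> 0 \<and> det (\<phi> (Rep_vertex v)) = 0"
    using Rep_vertex[of v] zero_divisor_iff_singular by simp
  then obtain L M where "\<phi> (Rep_vertex v) \<in> matrix_class L M" using singular_imp_class by blast
  then show ?thesis
    by (intro ex1I[of _ "(L, M)"]) (auto simp: vertex_class_def prod_eq_iff dest: matrix_class_unique)
qed

lemma vertex_type_eq_iff: "vertex_type \<phi> v = t \<longleftrightarrow> v \<in> vertex_class \<phi> t"
  unfolding vertex_type_def using ex1_vertex_class[of v] by (metis theI')

lemma card_vertex_class: "card (vertex_class \<phi> t) = CARD('p) - 1"
proof -
  have "bij_betw (\<lambda>v. \<phi> (Rep_vertex v)) (vertex_class \<phi> t) (matrix_class (fst t) (snd t))"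
  proof (rule bij_betw_imageI)
    have "inj \<phi>" using iso by (simp add: matrix_ring_iso_def bij_def)
    then show "inj_on (\<lambda>v. \<phi> (Rep_vertex v)) (vertex_class \<phi> t)"
      by (intro inj_onI) (metis injD Rep_vertex_inject)
    have "\<exists>v. A = \<phi> (Rep_vertex v)" if A: "A \<in> matrix_class (fst t) (snd t)" for A
    proof -
      obtain x where x: "A = \<phi> x" using iso_surj by blast
      then have "zero_divisor x" using A by (simp add: zero_divisor_iff_singular matrix_class_def)
      then show ?thesis using x Abs_vertex_inverse by (metis mem_Collect_eq)
    qed
    then show "(\<lambda>v. \<phi> (Rep_vertex v)) ` vertex_class \<phi> t = matrix_class (fst t) (snd t)"
      by (auto simp: vertex_class_def image_iff)
  qed
  then show ?thesis by (metis bij_betw_same_card card_matrix_class)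
qed

lemma adjacent_iff_type:
  "zd_adjacent (Rep_vertex v) (Rep_vertex w) \<longleftrightarrow> v \<noteq> w \<and>
     (snd (vertex_type \<phi> v) = fst (vertex_type \<phi> w) \<or> snd (vertex_type \<phi> w) = fst (vertex_type \<phi> v))"
proof -
  have cls: "\<phi> (Rep_vertex u) \<in> matrix_class (fst (vertex_type \<phi> u)) (snd (vertex_type \<phi> u))" for u
    using vertex_type_eq_iff[of u "vertex_type \<phi> u"] by (simp add: vertex_class_def)
  show ?thesis
    unfolding zd_adjacent_def mult_eq_0_iff_iso class_mult_eq_0_iff[OF cls cls]
    by (auto simp: Rep_vertex_inject)
qed

lemma twin_partition_vertex_type:
  "twin_partition (vertex_type \<phi>) H_matrix loop_correction adj_matrix"
proof
  show "surj (vertex_type \<phi>)"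
  proof -
    have "CARD('p) > 1" using prime_gt_1_nat[OF prime_card] .
    then have "vertex_class \<phi> t \<noteq> {}" for t using card_vertex_class[of t] by auto
    then show ?thesis unfolding surj_def by (metis ex_in_conv vertex_type_eq_iff)
  qed
  show "adj_matrix $ v $ w = H_matrix $ vertex_type \<phi> v $ vertex_type \<phi> w
      + (if v = w then loop_correction (vertex_type \<phi> v) else 0)" for v w
    by (auto simp: adj_matrix_def H_matrix_def loop_correction_def adjacent_iff_type)
qed

end

section \<open>The spectrum of the zero divisor graph\<close>

theorem theorem4p1:
  fixes p :: nat
    and \<phi> :: "'p::prime_card lipschitz \<Rightarrow> 'p mod_ring ^ 2 ^ 2"
    and A :: "real ^ 'p vertex ^ 'p vertex"
    and B :: "real ^ ('p line \<times> 'p line) ^ ('p line \<times> 'p line)"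
  assumes "p = CARD('p)" and "odd p"
    and "matrix_ring_iso \<phi>"
    and "A = adj_matrix"
    and "B = (real p - 1) *\<^sub>R H_matrix - D_matrix"
  shows "is_direct_sum (case_option (U_space \<phi>) (W_space \<phi>)) \<and>
    (\<forall>x \<in> U_space \<phi>. A *v x \<in> U_space \<phi>) \<and>
    (\<forall>t. \<forall>x \<in> W_space \<phi> t. A *v x \<in> W_space \<phi> t) \<and>
    has_matrix_in_basis ((*v) A) (U_space \<phi>) (class_indicator \<phi>) B \<and>
    (\<forall>L M. L \<noteq> M \<longrightarrow> (\<forall>x \<in> W_space \<phi> (L, M). A *v x = 0)) \<and>
    (\<forall>L. \<forall>x \<in> W_space \<phi> (L, L). A *v x = - x) \<and>
    charpoly A =
      [:0, 1:] ^ (p * (p + 1) * (p - 2)) * [:1, 1:] ^ ((p + 1) * (p - 2)) * charpoly B"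
proof -
  note iso = assms(3)
  interpret twin_partition "vertex_type \<phi>" H_matrix loop_correction adj_matrix
    using iso by (rule twin_partition_vertex_type)
  have p: "p > 1" using assms(1) prime_gt_1_nat[OF prime_card] by simp
  have fibre: "fibre t = vertex_class \<phi> t" for t
    by (auto simp: fibre_def vertex_type_eq_iff[OF iso])
  have card_fibre: "card (fibre t) = p - 1" for t
    using card_vertex_class[OF iso] assms(1) by (simp add: fibre)
  have indicator: "class_indicator \<phi> = fibre_indicator"
    by (auto simp: fun_eq_iff class_indicator_def fibre_indicator_def vertex_type_eq_iff[OF iso])
  have U: "U_space \<phi> = span (range fibre_indicator)"
    by (simp add: U_space_def indicator)
  have W: "W_space \<phi> = zero_sum"
    by (auto simp: fun_eq_iff W_space_def zero_sum_def fibre vertex_type_eq_iff[OF iso])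
  have B: "B = quotient_matrix"
    using p by (auto simp: assms(5) quotient_matrix_def card_fibre vec_eq_iff D_matrix_def
        loop_correction_def of_nat_diff)
  have "(\<Prod>t\<in>UNIV. [:- loop_correction t, 1:] ^ (card (fibre t) - 1))
      = [:0, 1:] ^ (p * (p + 1) * (p - 2)) * [:1, 1:] ^ ((p + 1) * (p - 2))"
  proof -
    let ?diag = "{t :: 'p line \<times> 'p line. fst t = snd t}"
    have "?diag = range (\<lambda>L. (L, L))" by auto
    then have diag: "card ?diag = p + 1"
      using card_line[where ?'p = 'p] assms(1) by (simp add: card_image inj_on_def)
    have "CARD('p line \<times> 'p line) = (p + 1) * (p + 1)"
      using card_line[where ?'p = 'p] assms(1) by simp
    then have off: "card (- ?diag) = p * (p + 1)"
      using diag by (simp add: Compl_eq_Diff_UNIV card_Diff_subset)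
    have "(\<Prod>t\<in>UNIV. [:- loop_correction t, 1:] ^ (card (fibre t) - 1))
        = (\<Prod>t::'p line \<times> 'p line\<in>UNIV. if fst t = snd t then [:1, 1:] ^ (p - 2) else [:0, 1:] ^ (p - 2))"
      by (rule prod.cong) (auto simp: loop_correction_def card_fibre numeral_2_eq_2)
    also have "\<dots> = ([:1, 1:] ^ (p - 2)) ^ card ?diag * ([:0, 1:] ^ (p - 2)) ^ card (- ?diag)"
      by (simp add: prod.If_cases)
    finally show ?thesis
      unfolding diag off power_mult[symmetric] by (simp add: mult.commute)
  qed
  then have "charpoly A = [:0, 1:] ^ (p * (p + 1) * (p - 2))
      * [:1, 1:] ^ ((p + 1) * (p - 2)) * charpoly B"
    using charpoly_eq by (simp only: B assms(4))
  then show ?thesis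
    unfolding assms(4) U W indicator
    using decomposition mult_span_fibre_indicator mult_zero_sum_invariant has_matrix_in_basis_fibre_indicator mult_zero_sum
    by (auto simp: B loop_correction_def)
qed

end
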